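(* Every set functor that preserves inverse images admits a greatest normal lax extension.
   Context: For a functor $F\colon\mathbf{Set}\to\mathbf{Set}$: relations $r\subseteq X\times Y$ are composed applicatively ($s\cdot r=\{(x,z)\mid\exists y.\ x\,r\,y\,s\,z\}$), $r^\circ$ is the converse, functions are regarded as relations, $1_X$ is the identity. An $F$-relator $R$ is a monotone assignment of $Rr\subseteq FX\times FY$ to each $r\subseteq X\times Y$; a lax extension is such an $R$ with $Ff\le Rf$ and $(Ff)^\circ\le R(f^\circ)$ for all functions $f$ and $Rs\cdot Rr\le R(s\cdot r)$ for all composable $r,s$; it is normal if $R1_X=1_{FX}$ for all $X$. Lax extensions are ordered pointwise ($R_1\le R_2$ iff $R_1r\subseteq R_2r$ for all $r$). $F$ preserves inverse images if it preserves pullbacks of a monomorphism along an arbitrary map. *)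

theory Defs
  imports "HOL-Library.FuncSet"
begin

text \<open>
  HOL has no type of all sets. The category Set is therefore represented by a collection \<open>U\<close> of
  "small" subsets of some type: objects are the members of \<open>U\<close>, morphisms from \<open>X\<close> to \<open>Y\<close> are the
  extensional functions \<open>f \<in> X \<rightarrow>\<^sub>E Y\<close>. Only closure properties shared by the small sets of a
  set-theoretic universe are imposed on \<open>U\<close>. The axioms also hold for the finite subsets, the
  countable subsets, or all subsets of a type with at least two elements.
\<close>

definition set_universe :: "'u set set \<Rightarrow> bool" where
  "set_universe U \<longleftrightarrow>
     (\<forall>X\<in>U. \<forall>Y. Y \<subseteq> X \<longrightarrow> Y \<in> U) \<and>
     (\<forall>X\<in>U. \<forall>f. f ` X \<in> U) \<and>
     (\<forall>X\<in>U. \<forall>Y\<in>U. X \<union> Y \<in> U) \<and>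
     (\<exists>X\<in>U. \<exists>x\<in>X. \<exists>y\<in>X. x \<noteq> y)"

text \<open>
  The codomain of a set functor may be presented by a universe \<open>V\<close> over another type, so that for
  example the powerset functor on all subsets of \<open>'u\<close> is included (with \<open>'v = 'u set\<close>); an
  endofunctor is the case \<open>V = U\<close>. Since an extensional function does not determine its codomain,
  the action on morphisms takes domain and codomain as arguments.
\<close>

definition set_functor ::
  "'u set set \<Rightarrow> 'v set set \<Rightarrow> ('u set \<Rightarrow> 'v set) \<Rightarrow>
   ('u set \<Rightarrow> 'u set \<Rightarrow> ('u \<Rightarrow> 'u) \<Rightarrow> ('v \<Rightarrow> 'v)) \<Rightarrow> bool" where
  "set_functor U V Fo Fm \<longleftrightarrow>
     (\<forall>X\<in>U. Fo X \<in> V) \<and>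
     (\<forall>X\<in>U. \<forall>Y\<in>U. \<forall>f \<in> X \<rightarrow>\<^sub>E Y. Fm X Y f \<in> Fo X \<rightarrow>\<^sub>E Fo Y) \<and>
     (\<forall>X\<in>U. Fm X X (\<lambda>x\<in>X. x) = (\<lambda>a\<in>Fo X. a)) \<and>
     (\<forall>X\<in>U. \<forall>Y\<in>U. \<forall>Z\<in>U. \<forall>f \<in> X \<rightarrow>\<^sub>E Y. \<forall>g \<in> Y \<rightarrow>\<^sub>E Z.
        Fm X Z (compose X g f) = compose (Fo X) (Fm Y Z g) (Fm X Y f))"

definition set_mono :: "'a set set \<Rightarrow> 'a set \<Rightarrow> 'a set \<Rightarrow> ('a \<Rightarrow> 'a) \<Rightarrow> bool" where
  "set_mono U X Y m \<longleftrightarrow> m \<in> X \<rightarrow>\<^sub>E Y \<and>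
     (\<forall>T\<in>U. \<forall>g \<in> T \<rightarrow>\<^sub>E X. \<forall>h \<in> T \<rightarrow>\<^sub>E X. compose T m g = compose T m h \<longrightarrow> g = h)"

text \<open>
  \<open>set_pullback U X Z Y f m P p q\<close> means that \<open>p\<close> from \<open>P\<close> to \<open>X\<close> and \<open>q\<close> from \<open>P\<close> to \<open>Z\<close> form a
  pullback of \<open>f\<close> from \<open>X\<close> to \<open>Y\<close> and \<open>m\<close> from \<open>Z\<close> to \<open>Y\<close>.
\<close>

definition set_pullback ::
  "'a set set \<Rightarrow> 'a set \<Rightarrow> 'a set \<Rightarrow> 'a set \<Rightarrow> ('a \<Rightarrow> 'a) \<Rightarrow> ('a \<Rightarrow> 'a) \<Rightarrow>
   'a set \<Rightarrow> ('a \<Rightarrow> 'a) \<Rightarrow> ('a \<Rightarrow> 'a) \<Rightarrow> bool" where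
  "set_pullback U X Z Y f m P p q \<longleftrightarrow>
     X \<in> U \<and> Z \<in> U \<and> Y \<in> U \<and> P \<in> U \<and>
     f \<in> X \<rightarrow>\<^sub>E Y \<and> m \<in> Z \<rightarrow>\<^sub>E Y \<and> p \<in> P \<rightarrow>\<^sub>E X \<and> q \<in> P \<rightarrow>\<^sub>E Z \<and>
     compose P f p = compose P m q \<and>
     (\<forall>T\<in>U. \<forall>g \<in> T \<rightarrow>\<^sub>E X. \<forall>h \<in> T \<rightarrow>\<^sub>E Z. compose T f g = compose T m h \<longrightarrow>
        (\<exists>!k. k \<in> T \<rightarrow>\<^sub>E P \<and> compose T p k = g \<and> compose T q k = h))"

definition preserves_inverse_images ::
  "'u set set \<Rightarrow> 'v set set \<Rightarrow> ('u set \<Rightarrow> 'v set) \<Rightarrow>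
   ('u set \<Rightarrow> 'u set \<Rightarrow> ('u \<Rightarrow> 'u) \<Rightarrow> ('v \<Rightarrow> 'v)) \<Rightarrow> bool" where
  "preserves_inverse_images U V Fo Fm \<longleftrightarrow>
     (\<forall>X Z Y f m P p q. set_pullback U X Z Y f m P p q \<and> set_mono U Z Y m \<longrightarrow>
        set_pullback V (Fo X) (Fo Z) (Fo Y) (Fm X Y f) (Fm Z Y m)
          (Fo P) (Fm P X p) (Fm P Z q))"

text \<open>
  A relation is considered together with its source and target, so a relator takes these as
  arguments; its values are only relevant for \<open>X, Y \<in> U\<close> and \<open>r \<subseteq> X \<times> Y\<close>. The applicative composite
  \<open>s \<cdot> r\<close> is \<open>r O s\<close>, and \<open>BNF_Def.Gr X f\<close> is the graph of \<open>f\<close> on \<open>X\<close>.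
\<close>

type_synonym ('u, 'v) relator_map = "'u set \<Rightarrow> 'u set \<Rightarrow> ('u \<times> 'u) set \<Rightarrow> ('v \<times> 'v) set"

definition relator ::
  "'u set set \<Rightarrow> ('u set \<Rightarrow> 'v set) \<Rightarrow> ('u, 'v) relator_map \<Rightarrow> bool" where
  "relator U Fo R \<longleftrightarrow>
     (\<forall>X\<in>U. \<forall>Y\<in>U. \<forall>r. r \<subseteq> X \<times> Y \<longrightarrow> R X Y r \<subseteq> Fo X \<times> Fo Y) \<and>
     (\<forall>X\<in>U. \<forall>Y\<in>U. \<forall>r s. r \<subseteq> s \<and> s \<subseteq> X \<times> Y \<longrightarrow> R X Y r \<subseteq> R X Y s)"

definition lax_extension ::
  "'u set set \<Rightarrow> ('u set \<Rightarrow> 'v set) \<Rightarrow> ('u set \<Rightarrow> 'u set \<Rightarrow> ('u \<Rightarrow> 'u) \<Rightarrow> ('v \<Rightarrow> 'v)) \<Rightarrow>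
   ('u, 'v) relator_map \<Rightarrow> bool" where
  "lax_extension U Fo Fm R \<longleftrightarrow>
     relator U Fo R \<and>
     (\<forall>X\<in>U. \<forall>Y\<in>U. \<forall>f \<in> X \<rightarrow>\<^sub>E Y.
        BNF_Def.Gr (Fo X) (Fm X Y f) \<subseteq> R X Y (BNF_Def.Gr X f) \<and>
        (BNF_Def.Gr (Fo X) (Fm X Y f))\<inverse> \<subseteq> R Y X ((BNF_Def.Gr X f)\<inverse>)) \<and>
     (\<forall>X\<in>U. \<forall>Y\<in>U. \<forall>Z\<in>U. \<forall>r s. r \<subseteq> X \<times> Y \<and> s \<subseteq> Y \<times> Z \<longrightarrow>
        R X Y r O R Y Z s \<subseteq> R X Z (r O s))"

definition normal_lax_extension ::
  "'u set set \<Rightarrow> ('u set \<Rightarrow> 'v set) \<Rightarrow> ('u set \<Rightarrow> 'u set \<Rightarrow> ('u \<Rightarrow> 'u) \<Rightarrow> ('v \<Rightarrow> 'v)) \<Rightarrow>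
   ('u, 'v) relator_map \<Rightarrow> bool" where
  "normal_lax_extension U Fo Fm R \<longleftrightarrow>
     lax_extension U Fo Fm R \<and> (\<forall>X\<in>U. R X X (Id_on X) = Id_on (Fo X))"

definition relator_le ::
  "'u set set \<Rightarrow> ('u, 'v) relator_map \<Rightarrow> ('u, 'v) relator_map \<Rightarrow> bool" where
  "relator_le U R1 R2 \<longleftrightarrow> (\<forall>X\<in>U. \<forall>Y\<in>U. \<forall>r. r \<subseteq> X \<times> Y \<longrightarrow> R1 X Y r \<subseteq> R2 X Y r)"

end

theory Submission
  imports Defs
begin

text \<open>
  Relate \<open>t \<in> F X\<close> and \<open>u \<in> F Y\<close> along \<open>r\<close> iff, for all subsets \<open>A \<subseteq> X\<close> and \<open>B \<subseteq> Y\<close> on which \<open>t\<close> and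
  \<open>u\<close> are supported and all maps \<open>f\<close> on \<open>A\<close> and \<open>g\<close> on \<open>B\<close> into a common set that agree on
  \<open>r\<close>-related points, \<open>F f\<close> and \<open>F g\<close> send \<open>t\<close> and \<open>u\<close> to the same element. Any normal lax
  extension must respect these observations, because \<open>g \<cdot> r \<cdot> f\<^sup>\<circ> \<subseteq> 1\<close>; so this relator is above
  all of them, and identities are among the observations, so it is normal.
  The only real issue is composition. Taking \<open>f\<close> constant and \<open>g\<close> a characteristic function,
  preservation of inverse images shows that supports propagate along \<open>r\<close>. Hence, given
  observations \<open>f\<close> on \<open>A\<close> and \<open>g\<close> on \<open>B\<close> that agree on \<open>s \<cdot> r\<close>, the intermediate element is
  supported on those points that are reachable from \<open>A\<close> and reach \<open>B\<close>, and on these points \<open>f\<close> and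
  \<open>g\<close> induce a common observation.
\<close>

definition observational_relator ::
  "'u set set \<Rightarrow> ('u set \<Rightarrow> 'v set) \<Rightarrow> ('u set \<Rightarrow> 'u set \<Rightarrow> ('u \<Rightarrow> 'u) \<Rightarrow> ('v \<Rightarrow> 'v)) \<Rightarrow>
   ('u, 'v) relator_map" where
  "observational_relator U Fo Fm X Y r =
     {(t, u). t \<in> Fo X \<and> u \<in> Fo Y \<and>
        (\<forall>A B Z f g a b. A \<subseteq> X \<longrightarrow> B \<subseteq> Y \<longrightarrow> Z \<in> U \<longrightarrow> f \<in> A \<rightarrow>\<^sub>E Z \<longrightarrow> g \<in> B \<rightarrow>\<^sub>E Z \<longrightarrow>
           (\<forall>x\<in>A. \<forall>y\<in>B. (x, y) \<in> r \<longrightarrow> f x = g y) \<longrightarrow> a \<in> Fo A \<longrightarrow> b \<in> Fo B \<longrightarrow>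
           Fm A X (\<lambda>x\<in>A. x) a = t \<longrightarrow> Fm B Y (\<lambda>y\<in>B. y) b = u \<longrightarrow> Fm A Z f a = Fm B Z g b)}"

section \<open>Points and inverse images in the category of small sets\<close>

lemma set_universe_subset: "set_universe U \<Longrightarrow> X \<in> U \<Longrightarrow> Y \<subseteq> X \<Longrightarrow> Y \<in> U"
  unfolding set_universe_def by blast

lemma set_universe_two_elements:
  assumes "set_universe U"
  obtains X x y where "X \<in> U" "x \<in> X" "y \<in> X" "x \<noteq> y"
proof -
  have "\<exists>X\<in>U. \<exists>x\<in>X. \<exists>y\<in>X. x \<noteq> y"
    using assms unfolding set_universe_def by (elim conjE)
  then show ?thesis using that by blast
qed

lemma set_universe_singleton:
  assumes "set_universe U"
  shows "{x} \<in> U"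
proof -
  obtain X y where X: "X \<in> U" "y \<in> X"
    using set_universe_two_elements[OF assms] by metis
  have "\<forall>X\<in>U. \<forall>f. f ` X \<in> U"
    using assms unfolding set_universe_def by (elim conjE)
  with X(1) have "(\<lambda>_. x) ` X \<in> U" by blast
  moreover have "(\<lambda>_. x) ` X = {x}" using X(2) by auto
  ultimately show ?thesis by simp
qed

text \<open>Points are maps out of a singleton, so testing the universal property on
  \<open>{x}\<close> turns each matching pair of elements into an element of the pullback.\<close>

lemma set_pullback_element:
  assumes U: "set_universe U" and P: "set_pullback U X Z Y f m P p q"
    and x: "x \<in> X" and z: "z \<in> Z" and eq: "f x = m z"
  obtains c where "c \<in> P" "p c = x" "q c = z"
proof -
  let ?T = "{x}"
  have T: "?T \<in> U" using set_universe_singleton[OF U] .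
  have g: "(\<lambda>_\<in>?T. x) \<in> ?T \<rightarrow>\<^sub>E X" and h: "(\<lambda>_\<in>?T. z) \<in> ?T \<rightarrow>\<^sub>E Z"
    using x z by auto
  have "compose ?T f (\<lambda>_\<in>?T. x) = compose ?T m (\<lambda>_\<in>?T. z)"
    using eq by (auto simp: compose_def)
  then obtain k where k: "k \<in> ?T \<rightarrow>\<^sub>E P" "compose ?T p k = (\<lambda>_\<in>?T. x)"
      "compose ?T q k = (\<lambda>_\<in>?T. z)"
    using P T g h unfolding set_pullback_def by metis
  have "k x \<in> P" using k(1) by auto
  moreover have "p (k x) = x" using fun_cong[OF k(2), of x] by (simp add: compose_def)
  moreover have "q (k x) = z" using fun_cong[OF k(3), of x] by (simp add: compose_def)
  ultimately show ?thesis using that by blast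
qed

lemma set_mono_inclusion:
  assumes "B \<subseteq> Y"
  shows "set_mono U B Y (\<lambda>y\<in>B. y)"
  unfolding set_mono_def
proof (intro conjI ballI impI)
  show "(\<lambda>y\<in>B. y) \<in> B \<rightarrow>\<^sub>E Y" using assms by auto
next
  fix T g h assume g: "g \<in> T \<rightarrow>\<^sub>E B" and h: "h \<in> T \<rightarrow>\<^sub>E B"
    and eq: "compose T (\<lambda>y\<in>B. y) g = compose T (\<lambda>y\<in>B. y) h"
  show "g = h"
  proof (rule PiE_ext[OF g h])
    fix x assume "x \<in> T"
    then show "g x = h x"
      using fun_cong[OF eq, of x] PiE_mem[OF g] PiE_mem[OF h] by (simp add: compose_def)
  qed
qed

lemma set_pullback_inverse_image:
  assumes U: "set_universe U" and XY: "X \<in> U" "Y \<in> U" and f: "f \<in> X \<rightarrow>\<^sub>E Y" and B: "B \<subseteq> Y"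
  defines "P \<equiv> {x \<in> X. f x \<in> B}"
  shows "set_pullback U X B Y f (\<lambda>y\<in>B. y) P (\<lambda>x\<in>P. x) (restrict f P)"
  unfolding set_pullback_def
proof (intro conjI ballI impI)
  show "X \<in> U" "Y \<in> U" "f \<in> X \<rightarrow>\<^sub>E Y" by fact+
  show "B \<in> U" "P \<in> U"
    using set_universe_subset[OF U] XY B by (auto simp: P_def)
  show "(\<lambda>y\<in>B. y) \<in> B \<rightarrow>\<^sub>E Y" "(\<lambda>x\<in>P. x) \<in> P \<rightarrow>\<^sub>E X" "restrict f P \<in> P \<rightarrow>\<^sub>E B"
    using B by (auto simp: P_def)
  show "compose P f (\<lambda>x\<in>P. x) = compose P (\<lambda>y\<in>B. y) (restrict f P)"
    by (auto simp: compose_def P_def)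
next
  fix T g h assume g: "g \<in> T \<rightarrow>\<^sub>E X" and h: "h \<in> T \<rightarrow>\<^sub>E B"
    and eq: "compose T f g = compose T (\<lambda>y\<in>B. y) h"
  have fg: "f (g x) = h x" if "x \<in> T" for x
    using fun_cong[OF eq, of x] that h by (auto simp: compose_def PiE_mem)
  have gP: "g \<in> T \<rightarrow>\<^sub>E P"
    using g h fg by (auto simp: P_def PiE_iff)
  show "\<exists>!k. k \<in> T \<rightarrow>\<^sub>E P \<and> compose T (\<lambda>x\<in>P. x) k = g \<and> compose T (restrict f P) k = h"
  \<comment> \<open>The projection from \<open>P\<close> to \<open>X\<close> is an inclusion, so the
    mediating map is \<open>g\<close> itself and no other map qualifies.\<close>
  proof (rule ex1I[of _ g], intro conjI)
    show "g \<in> T \<rightarrow>\<^sub>E P" by (fact gP)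
    show "compose T (\<lambda>x\<in>P. x) g = g"
      using gP by (auto simp: compose_def PiE_iff extensional_def fun_eq_iff)
    show "compose T (restrict f P) g = h"
      using gP h fg by (auto simp: compose_def PiE_iff extensional_def fun_eq_iff)
  next
    fix k assume k: "k \<in> T \<rightarrow>\<^sub>E P \<and> compose T (\<lambda>x\<in>P. x) k = g \<and> compose T (restrict f P) k = h"
    then have "k \<in> T \<rightarrow>\<^sub>E P" by blast
    then have "compose T (\<lambda>x\<in>P. x) k = k"
      by (auto simp: compose_def PiE_iff extensional_def fun_eq_iff)
    with k show "k = g" by simp
  qed
qed

lemma relator_mono:
  assumes "relator U Fo R" "X \<in> U" "Y \<in> U" "r \<subseteq> s" "s \<subseteq> X \<times> Y"
  shows "R X Y r \<subseteq> R X Y s"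
  using assms unfolding relator_def by simp

lemma lax_extension_functionD:
  assumes "lax_extension U Fo Fm R" "X \<in> U" "Y \<in> U" "f \<in> X \<rightarrow>\<^sub>E Y" "a \<in> Fo X"
  shows "(a, Fm X Y f a) \<in> R X Y (BNF_Def.Gr X f)"
    and "(Fm X Y f a, a) \<in> R Y X ((BNF_Def.Gr X f)\<inverse>)"
  using assms unfolding lax_extension_def BNF_Def.Gr_def by blast+

lemma lax_extension_comp:
  assumes "lax_extension U Fo Fm R" "X \<in> U" "Y \<in> U" "Z \<in> U" "r \<subseteq> X \<times> Y" "s \<subseteq> Y \<times> Z"
    and "(a, b) \<in> R X Y r" "(b, c) \<in> R Y Z s"
  shows "(a, c) \<in> R X Z (r O s)"
  using assms unfolding lax_extension_def by blast

lemma Gr_subset_Times: "f \<in> X \<rightarrow>\<^sub>E Y \<Longrightarrow> BNF_Def.Gr X f \<subseteq> X \<times> Y"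
  by (auto simp: BNF_Def.Gr_def)

section \<open>Lifting elements along inverse images\<close>

locale inverse_image_functor =
  fixes U :: "'u set set" and V :: "'v set set"
    and Fo :: "'u set \<Rightarrow> 'v set"
    and Fm :: "'u set \<Rightarrow> 'u set \<Rightarrow> ('u \<Rightarrow> 'u) \<Rightarrow> ('v \<Rightarrow> 'v)"
  assumes U: "set_universe U" and V: "set_universe V"
    and functoriality: "set_functor U V Fo Fm"
    and inverse_images: "preserves_inverse_images U V Fo Fm"
begin

abbreviation incl :: "'u set \<Rightarrow> 'u \<Rightarrow> 'u" where
  "incl A \<equiv> \<lambda>x\<in>A. x"

abbreviation Obs :: "('u, 'v) relator_map" where
  "Obs \<equiv> observational_relator U Fo Fm"

lemmas sub = set_universe_subset[OF U]

lemma Fm_in: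
  assumes "X \<in> U" "Y \<in> U" "f \<in> X \<rightarrow>\<^sub>E Y" "a \<in> Fo X"
  shows "Fm X Y f a \<in> Fo Y"
  using functoriality assms unfolding set_functor_def by (meson PiE_mem)

lemma Fm_id: "X \<in> U \<Longrightarrow> a \<in> Fo X \<Longrightarrow> Fm X X (incl X) a = a"
  using functoriality unfolding set_functor_def by simp

lemma Fm_comp:
  assumes "X \<in> U" "Y \<in> U" "Z \<in> U" "f \<in> X \<rightarrow>\<^sub>E Y" "g \<in> Y \<rightarrow>\<^sub>E Z" "a \<in> Fo X"
  shows "Fm Y Z g (Fm X Y f a) = Fm X Z (\<lambda>x\<in>X. g (f x)) a"
proof -
  have "Fm X Z (compose X g f) = compose (Fo X) (Fm Y Z g) (Fm X Y f)"
    using functoriality assms unfolding set_functor_def by blast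
  then show ?thesis using assms(6) by (simp add: compose_def)
qed

text \<open>Every use of preservation of inverse images passes through this elementwise form. Giving
  \<open>P\<close> by an equation lets callers supply a set of another shape, such as an
  intersection or a relational image.\<close>

lemma inverse_image_lift:
  assumes X: "X \<in> U" and Y: "Y \<in> U" and f: "f \<in> X \<rightarrow>\<^sub>E Y" and B: "B \<subseteq> Y"
    and a: "a \<in> Fo X" and b: "b \<in> Fo B" and eq: "Fm X Y f a = Fm B Y (incl B) b"
    and P: "P = {x \<in> X. f x \<in> B}"
  obtains c where "c \<in> Fo P" "Fm P X (incl P) c = a" "Fm P B (restrict f P) c = b"
proof -
  have "set_pullback U X B Y f (incl B) P (incl P) (restrict f P)"
    unfolding P by (rule set_pullback_inverse_image[OF U X Y f B])
  then have "set_pullback V (Fo X) (Fo B) (Fo Y) (Fm X Y f) (Fm B Y (incl B)) (Fo P)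
      (Fm P X (incl P)) (Fm P B (restrict f P))"
    using inverse_images set_mono_inclusion[OF B] unfolding preserves_inverse_images_def by blast
  from set_pullback_element[OF V this a b eq] show ?thesis using that by blast
qed

text \<open>The intersection is the inverse image of \<open>B\<close> under the inclusion of
  \<open>A\<close>, so two supports of an element intersect in a support.\<close>

lemma intersection_lift:
  assumes Y: "Y \<in> U" and A: "A \<subseteq> Y" and B: "B \<subseteq> Y" and a: "a \<in> Fo A" and b: "b \<in> Fo B"
    and eq: "Fm A Y (incl A) a = Fm B Y (incl B) b"
  obtains c where "c \<in> Fo (A \<inter> B)" "Fm (A \<inter> B) Y (incl (A \<inter> B)) c = Fm A Y (incl A) a"
proof -
  have AU: "A \<in> U" "A \<inter> B \<in> U" using A by (auto intro: sub[OF Y])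
  have iA: "incl A \<in> A \<rightarrow>\<^sub>E Y" "incl (A \<inter> B) \<in> A \<inter> B \<rightarrow>\<^sub>E A" using A by auto
  obtain c where c: "c \<in> Fo (A \<inter> B)" "Fm (A \<inter> B) A (incl (A \<inter> B)) c = a"
  proof (rule inverse_image_lift[OF AU(1) Y iA(1) B a b eq])
    show "A \<inter> B = {x \<in> A. incl A x \<in> B}" by auto
  qed
  have "(\<lambda>x\<in>A \<inter> B. incl A (incl (A \<inter> B) x)) = incl (A \<inter> B)" by (auto simp: fun_eq_iff)
  then have "Fm (A \<inter> B) Y (incl (A \<inter> B)) c = Fm A Y (incl A) a"
    using Fm_comp[OF AU(2,1) Y iA(2,1) c(1)] c(2) by simp
  with c(1) show ?thesis using that by blast
qed

section \<open>Observations, their symmetry, and transport of supports\<close>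

lemma ObsI:
  assumes "t \<in> Fo X" "u \<in> Fo Y"
    and "\<And>A B Z f g a b. A \<subseteq> X \<Longrightarrow> B \<subseteq> Y \<Longrightarrow> Z \<in> U \<Longrightarrow> f \<in> A \<rightarrow>\<^sub>E Z \<Longrightarrow> g \<in> B \<rightarrow>\<^sub>E Z \<Longrightarrow>
      (\<And>x y. x \<in> A \<Longrightarrow> y \<in> B \<Longrightarrow> (x, y) \<in> r \<Longrightarrow> f x = g y) \<Longrightarrow> a \<in> Fo A \<Longrightarrow> b \<in> Fo B \<Longrightarrow>
      Fm A X (incl A) a = t \<Longrightarrow> Fm B Y (incl B) b = u \<Longrightarrow> Fm A Z f a = Fm B Z g b"
  shows "(t, u) \<in> Obs X Y r"
  unfolding observational_relator_def using assms by simp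

lemma ObsD:
  assumes "(t, u) \<in> Obs X Y r"
    and "A \<subseteq> X" "B \<subseteq> Y" "Z \<in> U" "f \<in> A \<rightarrow>\<^sub>E Z" "g \<in> B \<rightarrow>\<^sub>E Z"
    and "\<And>x y. x \<in> A \<Longrightarrow> y \<in> B \<Longrightarrow> (x, y) \<in> r \<Longrightarrow> f x = g y" "a \<in> Fo A" "b \<in> Fo B"
    and "Fm A X (incl A) a = t" "Fm B Y (incl B) b = u"
  shows "Fm A Z f a = Fm B Z g b"
  using assms unfolding observational_relator_def by simp

lemma Obs_carrier: "(t, u) \<in> Obs X Y r \<Longrightarrow> t \<in> Fo X \<and> u \<in> Fo Y"
  unfolding observational_relator_def by simp

text \<open>The defining condition is symmetric: exchange the two observations. This spares separate
  arguments for converses of functions and for supports moving backwards.\<close>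

lemma Obs_converse:
  assumes "(t, u) \<in> Obs X Y r"
  shows "(u, t) \<in> Obs Y X (r\<inverse>)"
proof (rule ObsI)
  show "u \<in> Fo Y" "t \<in> Fo X" using Obs_carrier[OF assms] by auto
next
  fix A B Z f g a b
  assume *: "A \<subseteq> Y" "B \<subseteq> X" "Z \<in> U" "f \<in> A \<rightarrow>\<^sub>E Z" "g \<in> B \<rightarrow>\<^sub>E Z"
    "\<And>x y. x \<in> A \<Longrightarrow> y \<in> B \<Longrightarrow> (x, y) \<in> r\<inverse> \<Longrightarrow> f x = g y" "a \<in> Fo A" "b \<in> Fo B"
    "Fm A Y (incl A) a = u" "Fm B X (incl B) b = t"
  have "Fm B Z g b = Fm A Z f a"
    by (rule ObsD[OF assms *(2,1,3,5,4) _ *(8,7,10,9)]) (use *(6) in auto)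
  then show "Fm A Z f a = Fm B Z g b" by simp
qed

text \<open>
  The observation used here is the constant map on \<open>A\<close> against the characteristic function of
  \<open>r `` A\<close>, both with values in a two-element set.
\<close>

lemma Obs_support:
  assumes X: "X \<in> U" and Y: "Y \<in> U" and r: "r \<subseteq> X \<times> Y" and tu: "(t, u) \<in> Obs X Y r"
    and A: "A \<subseteq> X" and a: "a \<in> Fo A" "Fm A X (incl A) a = t"
  obtains b where "b \<in> Fo (r `` A)" "Fm (r `` A) Y (incl (r `` A)) b = u"
proof -
  have u: "u \<in> Fo Y" using Obs_carrier[OF tu] by simp
  have AU: "A \<in> U" using sub[OF X A] .
  obtain D p q where D: "D \<in> U" "p \<in> D" "q \<in> D" "p \<noteq> q"
    using set_universe_two_elements[OF U] .
  have pU: "{p} \<in> U" using set_universe_singleton[OF U] .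
  define f where "f = (\<lambda>x\<in>A. p)"
  define g where "g = (\<lambda>y\<in>Y. if y \<in> r `` A then p else q)"
  have f: "f \<in> A \<rightarrow>\<^sub>E D" "f \<in> A \<rightarrow>\<^sub>E {p}" and g: "g \<in> Y \<rightarrow>\<^sub>E D" and i: "incl {p} \<in> {p} \<rightarrow>\<^sub>E D"
    using D unfolding f_def g_def by auto
  have "Fm A D f a = Fm Y D g u"
    \<comment> \<open>By \<open>Fm_id\<close>, \<open>u\<close> counts as supported on all of
      \<open>Y\<close>, so \<open>g\<close> may be total.\<close>
    by (rule ObsD[OF tu A _ D(1) f(1) g _ a(1) u a(2) Fm_id[OF Y u]])
      (auto simp: f_def g_def)
  \<comment> \<open>Since \<open>f\<close> factors through \<open>{p}\<close>, the element
    \<open>Fm Y D g u\<close> comes from \<open>Fo {p}\<close>; as \<open>p\<close> and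
    \<open>q\<close> differ, the inverse image of \<open>{p}\<close> under \<open>g\<close> is
    exactly the image of \<open>A\<close> under \<open>r\<close>.\<close>
  moreover have "Fm {p} D (incl {p}) (Fm A {p} f a) = Fm A D (\<lambda>x\<in>A. incl {p} (f x)) a"
    by (rule Fm_comp[OF AU pU D(1) f(2) i a(1)])
  moreover have "(\<lambda>x\<in>A. incl {p} (f x)) = f" unfolding f_def by auto
  ultimately have eq: "Fm Y D g u = Fm {p} D (incl {p}) (Fm A {p} f a)" by simp
  have "{p} \<subseteq> D" using D by simp
  moreover have "r `` A = {y \<in> Y. g y \<in> {p}}" using r D by (auto simp: g_def)
  ultimately show ?thesis
    using inverse_image_lift[OF Y D(1) g _ u Fm_in[OF AU pU f(2) a(1)] eq] that by metis
qed

section \<open>The axioms of a normal lax extension\<close>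

lemma Obs_mono: "r \<subseteq> s \<Longrightarrow> Obs X Y r \<subseteq> Obs X Y s"
  \<comment> \<open>A larger relation leaves fewer compatible pairs of observations to test.\<close>
  unfolding observational_relator_def by (auto simp: subset_iff)

text \<open>The supports \<open>a\<close> and \<open>b\<close> lift to a common \<open>c\<close>
  over the points of \<open>A\<close> that \<open>h\<close> sends into \<open>B\<close>. There
  \<open>f\<close> coincides with \<open>g\<close> after \<open>h\<close>, so both observations of
  \<open>c\<close> agree.\<close>

lemma Obs_function:
  assumes X: "X \<in> U" and Y: "Y \<in> U" and h: "h \<in> X \<rightarrow>\<^sub>E Y" and t: "t \<in> Fo X"
  shows "(t, Fm X Y h t) \<in> Obs X Y (BNF_Def.Gr X h)"
proof (rule ObsI)
  show "t \<in> Fo X" "Fm X Y h t \<in> Fo Y" using Fm_in[OF X Y h t] t by auto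
next
  fix A B Z f g a b
  assume A: "A \<subseteq> X" and B: "B \<subseteq> Y" and Z: "Z \<in> U" and f: "f \<in> A \<rightarrow>\<^sub>E Z" and g: "g \<in> B \<rightarrow>\<^sub>E Z"
    and fg: "\<And>x y. x \<in> A \<Longrightarrow> y \<in> B \<Longrightarrow> (x, y) \<in> BNF_Def.Gr X h \<Longrightarrow> f x = g y"
    and a: "a \<in> Fo A" and b: "b \<in> Fo B"
    and at: "Fm A X (incl A) a = t" and bt: "Fm B Y (incl B) b = Fm X Y h t"
  define P where "P = {x \<in> A. restrict h A x \<in> B}"
  have AU: "A \<in> U" and BU: "B \<in> U" and PU: "P \<in> U"
    using A B unfolding P_def by (auto intro: sub[OF X] sub[OF Y])
  have hA: "restrict h A \<in> A \<rightarrow>\<^sub>E Y" and iA: "incl A \<in> A \<rightarrow>\<^sub>E X" using h A by auto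
  have iP: "incl P \<in> P \<rightarrow>\<^sub>E A" by (auto simp: P_def)
  have hP: "restrict (restrict h A) P \<in> P \<rightarrow>\<^sub>E B"
    by (rule restrict_PiE_iff[THEN iffD2]) (simp add: P_def)
  have "(\<lambda>x\<in>A. h (incl A x)) = restrict h A" by auto
  then have "Fm A Y (restrict h A) a = Fm B Y (incl B) b"
    using Fm_comp[OF AU X Y iA h a] at bt by simp
  from inverse_image_lift[OF AU Y hA B a b this P_def]
  obtain c where c: "c \<in> Fo P" "Fm P A (incl P) c = a" "Fm P B (restrict (restrict h A) P) c = b" .
  have "Fm A Z f a = Fm P Z (\<lambda>x\<in>P. f (incl P x)) c"
    using Fm_comp[OF PU AU Z iP f c(1)] c(2) by simp
  also have "(\<lambda>x\<in>P. f (incl P x)) = (\<lambda>x\<in>P. g (restrict (restrict h A) P x))"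
    using fg A by (auto simp: P_def BNF_Def.Gr_def fun_eq_iff)
  also have "Fm P Z (\<lambda>x\<in>P. g (restrict (restrict h A) P x)) c = Fm B Z g b"
    using Fm_comp[OF PU BU Z hP g c(1)] c(3) by simp
  finally show "Fm A Z f a = Fm B Z g b" .
qed

lemma Obs_comp:
  assumes X: "X \<in> U" and Y: "Y \<in> U" and W: "W \<in> U" and r: "r \<subseteq> X \<times> Y" and s: "s \<subseteq> Y \<times> W"
    and tu: "(t, u) \<in> Obs X Y r" and uw: "(u, w) \<in> Obs Y W s"
  shows "(t, w) \<in> Obs X W (r O s)"
proof (rule ObsI)
  show "t \<in> Fo X" "w \<in> Fo W" using Obs_carrier[OF tu] Obs_carrier[OF uw] by auto
next
  fix A B Z f g a b
  assume A: "A \<subseteq> X" and B: "B \<subseteq> W" and Z: "Z \<in> U" and f: "f \<in> A \<rightarrow>\<^sub>E Z" and g: "g \<in> B \<rightarrow>\<^sub>E Z"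
    and fg: "\<And>x y. x \<in> A \<Longrightarrow> y \<in> B \<Longrightarrow> (x, y) \<in> r O s \<Longrightarrow> f x = g y"
    and a: "a \<in> Fo A" and b: "b \<in> Fo B"
    and at: "Fm A X (incl A) a = t" and bw: "Fm B W (incl B) b = w"
  \<comment> \<open>Support of \<open>u\<close> is obtained twice: forwards from \<open>t\<close>
    along \<open>r\<close>, and backwards from \<open>w\<close> along the converse of
    \<open>s\<close>.\<close>
  obtain c where c: "c \<in> Fo (r `` A)" "Fm (r `` A) Y (incl (r `` A)) c = u"
    using Obs_support[OF X Y r tu A a at] .
  have s': "s\<inverse> \<subseteq> W \<times> Y" using s by auto
  obtain d where d: "d \<in> Fo (s\<inverse> `` B)" "Fm (s\<inverse> `` B) Y (incl (s\<inverse> `` B)) d = u"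
    using Obs_support[OF W Y s' Obs_converse[OF uw] B b bw] .
  define M where "M = r `` A \<inter> s\<inverse> `` B"
  have sub_Y: "r `` A \<subseteq> Y" "s\<inverse> `` B \<subseteq> Y" "M \<subseteq> Y" using r s by (auto simp: M_def)
  obtain m where m: "m \<in> Fo M" "Fm M Y (incl M) m = u"
    using intersection_lift[OF Y sub_Y(1,2) c(1) d(1)] c(2) d(2) unfolding M_def by metis
  \<comment> \<open>The choice of \<open>x\<close> is harmless on \<open>M\<close>: each
    \<open>y\<close> there reaches some \<open>z\<close> in \<open>B\<close>, which forces
    \<open>f x = g z\<close>. Outside \<open>M\<close>, predecessors of \<open>y\<close> in
    \<open>A\<close> may have different values under \<open>f\<close>; hence observations have to be
    partial.\<close>
  define k where "k = (\<lambda>y\<in>M. f (SOME x. x \<in> A \<and> (x, y) \<in> r))"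
  have k_some: "\<exists>x\<in>A. (x, y) \<in> r \<and> k y = f x" if "y \<in> M" for y
  proof -
    have "\<exists>x. x \<in> A \<and> (x, y) \<in> r" using that by (auto simp: M_def)
    from someI_ex[OF this] show ?thesis using that by (auto simp: k_def)
  qed
  have kg: "k y = g z" if "y \<in> M" "z \<in> B" "(y, z) \<in> s" for y z
    using k_some[OF that(1)] fg that(2,3) by (metis relcomp.relcompI)
  have fk: "f x = k y" if xy: "x \<in> A" "y \<in> M" "(x, y) \<in> r" for x y
  proof -
    obtain z where "z \<in> B" "(y, z) \<in> s" using xy by (auto simp: M_def)
    then show ?thesis using kg fg xy by (metis relcomp.relcompI)
  qed
  have "k y \<in> Z" if "y \<in> M" for y using k_some[OF that] f by auto
  then have k: "k \<in> M \<rightarrow>\<^sub>E Z" by (auto simp: k_def)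
  have "Fm A Z f a = Fm M Z k m"
    by (rule ObsD[OF tu A sub_Y(3) Z f k fk a m(1) at m(2)])
  also have "\<dots> = Fm B Z g b"
    by (rule ObsD[OF uw sub_Y(3) B Z k g kg m(1) b m(2) bw])
  finally show "Fm A Z f a = Fm B Z g b" .
qed

lemma lax_extension_Obs: "lax_extension U Fo Fm Obs"
  unfolding lax_extension_def relator_def
proof (intro conjI ballI allI impI)
  fix X Y :: "'u set" and r
  show "Obs X Y r \<subseteq> Fo X \<times> Fo Y" using Obs_carrier by auto
next
  fix X Y :: "'u set" and r s assume "r \<subseteq> s \<and> s \<subseteq> X \<times> Y"
  then show "Obs X Y r \<subseteq> Obs X Y s" using Obs_mono by simp
next
  fix X Y f assume *: "X \<in> U" "Y \<in> U" "f \<in> X \<rightarrow>\<^sub>E Y"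
  show "BNF_Def.Gr (Fo X) (Fm X Y f) \<subseteq> Obs X Y (BNF_Def.Gr X f)"
    using Obs_function[OF *] by (auto simp: BNF_Def.Gr_def)
  show "(BNF_Def.Gr (Fo X) (Fm X Y f))\<inverse> \<subseteq> Obs Y X ((BNF_Def.Gr X f)\<inverse>)"
    using Obs_converse[OF Obs_function[OF *]] by (auto simp: BNF_Def.Gr_def)
next
  fix X Y Z r s
  assume "X \<in> U" "Y \<in> U" "Z \<in> U" "r \<subseteq> X \<times> Y \<and> s \<subseteq> Y \<times> Z"
  then show "Obs X Y r O Obs Y Z s \<subseteq> Obs X Z (r O s)" using Obs_comp by blast
qed

text \<open>The identity paired with itself respects the diagonal, and this single test already
  forces equality. Conversely, the diagonal is the graph of the identity.\<close>

lemma Obs_Id: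
  assumes X: "X \<in> U"
  shows "Obs X X (Id_on X) = Id_on (Fo X)"
proof (rule antisym; rule subrelI)
  fix t u assume tu: "(t, u) \<in> Obs X X (Id_on X)"
  have t: "t \<in> Fo X" and u: "u \<in> Fo X" using Obs_carrier[OF tu] by auto
  have i: "incl X \<in> X \<rightarrow>\<^sub>E X" by auto
  have "Fm X X (incl X) t = Fm X X (incl X) u"
    by (rule ObsD[OF tu _ _ X i i _ t u Fm_id[OF X t] Fm_id[OF X u]]) auto
  then show "(t, u) \<in> Id_on (Fo X)" using Fm_id[OF X] t u by auto
next
  fix t u assume "(t, u) \<in> Id_on (Fo X)"
  then have t: "t \<in> Fo X" and "u = t" by auto
  moreover have "BNF_Def.Gr X (incl X) = Id_on X" by (auto simp: BNF_Def.Gr_def)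
  ultimately show "(t, u) \<in> Obs X X (Id_on X)"
    using Obs_function[OF X X _ t, of "incl X"] Fm_id[OF X t] by auto
qed

section \<open>Maximality among normal lax extensions\<close>

lemma normal_lax_extension_le_Obs:
  assumes R: "normal_lax_extension U Fo Fm R"
  shows "relator_le U R Obs"
  unfolding relator_le_def
proof (intro ballI allI impI subrelI)
  fix X Y r t u assume X: "X \<in> U" and Y: "Y \<in> U" and r: "r \<subseteq> X \<times> Y" and tu: "(t, u) \<in> R X Y r"
  have lax: "lax_extension U Fo Fm R" using R unfolding normal_lax_extension_def by simp
  have rel: "relator U Fo R" using lax unfolding lax_extension_def by simp
  show "(t, u) \<in> Obs X Y r"
  proof (rule ObsI)
    show "t \<in> Fo X" "u \<in> Fo Y" using rel X Y r tu unfolding relator_def by blast+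
  next
    fix A B Z f g a b
    assume A: "A \<subseteq> X" and B: "B \<subseteq> Y" and Z: "Z \<in> U" and f: "f \<in> A \<rightarrow>\<^sub>E Z" and g: "g \<in> B \<rightarrow>\<^sub>E Z"
      and fg: "\<And>x y. x \<in> A \<Longrightarrow> y \<in> B \<Longrightarrow> (x, y) \<in> r \<Longrightarrow> f x = g y"
      and a: "a \<in> Fo A" and b: "b \<in> Fo B"
      and at: "Fm A X (incl A) a = t" and bu: "Fm B Y (incl B) b = u"
    have AU: "A \<in> U" and BU: "B \<in> U" using sub[OF X A] sub[OF Y B] .
    have iA: "incl A \<in> A \<rightarrow>\<^sub>E X" and iB: "incl B \<in> B \<rightarrow>\<^sub>E Y" using A B by auto
    let ?G = "BNF_Def.Gr"
    \<comment> \<open>\<open>?r1\<close> leads from an observed value back through \<open>A\<close>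
      into \<open>X\<close>, and \<open>?r2\<close> from \<open>Y\<close> back through
      \<open>B\<close> to an observed value; around \<open>r\<close> they give a relation on
      \<open>Z\<close>.\<close>
    let ?r1 = "(?G A f)\<inverse> O ?G A (incl A)" and ?r2 = "(?G B (incl B))\<inverse> O ?G B g"
    have sub1: "(?G A f)\<inverse> \<subseteq> Z \<times> A" "?G A (incl A) \<subseteq> A \<times> X"
        "(?G B (incl B))\<inverse> \<subseteq> Y \<times> B" "?G B g \<subseteq> B \<times> Z"
      using Gr_subset_Times[OF f] Gr_subset_Times[OF iA] Gr_subset_Times[OF g]
        Gr_subset_Times[OF iB] by auto
    have 1: "(Fm A Z f a, t) \<in> R Z X ?r1"
      using lax_extension_comp[OF lax Z AU X sub1(1,2) lax_extension_functionD(2)[OF lax AU Z f a]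
        lax_extension_functionD(1)[OF lax AU X iA a]] at by simp
    have 2: "(u, Fm B Z g b) \<in> R Y Z ?r2"
      using lax_extension_comp[OF lax Y BU Z sub1(3,4) lax_extension_functionD(2)[OF lax BU Y iB b]
        lax_extension_functionD(1)[OF lax BU Z g b]] bu by simp
    have sub2: "?r1 \<subseteq> Z \<times> X" "?r2 \<subseteq> Y \<times> Z" "?r1 O r \<subseteq> Z \<times> Y"
      using sub1 r by auto
    have "(Fm A Z f a, u) \<in> R Z Y (?r1 O r)"
      by (rule lax_extension_comp[OF lax Z X Y sub2(1) r 1 tu])
    from lax_extension_comp[OF lax Z Y Z sub2(3,2) this 2]
    have "(Fm A Z f a, Fm B Z g b) \<in> R Z Z ((?r1 O r) O ?r2)" .
    \<comment> \<open>A pair in the composite is \<open>(f x, g y)\<close> with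
      \<open>(x, y)\<close> in \<open>r\<close>, so \<open>fg\<close> puts it on the diagonal;
      monotonicity and normality then yield equality.\<close>
    moreover have "(?r1 O r) O ?r2 \<subseteq> Id_on Z"
      using fg f g by (auto simp: BNF_Def.Gr_def)
    moreover have "Id_on Z \<subseteq> Z \<times> Z" by auto
    ultimately have "(Fm A Z f a, Fm B Z g b) \<in> R Z Z (Id_on Z)"
      using relator_mono[OF rel Z Z] by (meson subsetD)
    also have "R Z Z (Id_on Z) = Id_on (Fo Z)"
      using R Z unfolding normal_lax_extension_def by simp
    finally show "Fm A Z f a = Fm B Z g b" by auto
  qed
qed

end

theorem theorem28:
  fixes U :: "'u set set" and V :: "'v set set"
    and Fo :: "'u set \<Rightarrow> 'v set"
    and Fm :: "'u set \<Rightarrow> 'u set \<Rightarrow> ('u \<Rightarrow> 'u) \<Rightarrow> ('v \<Rightarrow> 'v)"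
  assumes "set_universe U" and "set_universe V"
    and "set_functor U V Fo Fm"
    and "preserves_inverse_images U V Fo Fm"
  shows "\<exists>R. normal_lax_extension U Fo Fm R \<and>
           (\<forall>R'. normal_lax_extension U Fo Fm R' \<longrightarrow> relator_le U R' R)"
proof -
  interpret inverse_image_functor U V Fo Fm
    using assms by unfold_locales
  have "normal_lax_extension U Fo Fm Obs"
    using lax_extension_Obs Obs_Id unfolding normal_lax_extension_def by blast
  with normal_lax_extension_le_Obs show ?thesis by blast
qed

end
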